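(* Let $k\ge 1$, let $P_{k-1}\in\mathbb{R}^{d_{in}\times d_{in}}$ be the cumulative orthogonal projection matrix available before task $k$ (so $P_{k-1}^T=P_{k-1}$ and $P_{k-1}^2=P_{k-1}$), and let $\mathcal{L}(\tilde A_k,B_k)$ be the training loss for task $k$, a differentiable function of $\tilde A_k\in\mathbb{R}^{d_{in}\times r}$ and $B_k\in\mathbb{R}^{r\times d_{out}}$, where $\tilde A_k=P_{k-1}A_k$ with $A_k\in\mathbb{R}^{d_{in}\times r}$ the trainable parameter. Let $\nabla_{\tilde A_k}\mathcal{L}$ denote the gradient of $\mathcal{L}$ with respect to its first argument, evaluated at $(P_{k-1}A_k,B_k)$, and let $\nabla_{A_k}\mathcal{L}$ denote the gradient at $A_k$ of the map $A\mapsto \mathcal{L}(P_{k-1}A,B_k)$. Then for all $A_k\in\mathbb{R}^{d_{in}\times r}$ and $B_k\in\mathbb{R}^{r\times d_{out}}$, $$\nabla_{A_k}\mathcal{L}=P_{k-1}\,\nabla_{\tilde A_k}\mathcal{L}.$$ Therefore every gradient step on $A_k$ lies in $\mathrm{Range}(P_{k-1})$ (that is, every column of $\nabla_{A_k}\mathcal{L}$ lies in the column space of $P_{k-1}$). In particular, $$(I-P_{k-1})\,\nabla_{A_k}\mathcal{L}=0.$$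
   Context: Gradients with respect to matrices are taken with respect to the Frobenius inner product $\langle X,Y\rangle=\mathrm{tr}(X^TY)$, so $d\mathcal{L}=\langle\nabla_{A}\mathcal{L},dA\rangle$; $I$ is the $d_{in}\times d_{in}$ identity matrix. Setting. $W_{base}\in\mathbb{R}^{d_{in}\times d_{out}}$ is a fixed (frozen) weight matrix of one layer of a neural network $f(x;W)$, where $W$ is the weight matrix used in that layer. Tasks arrive in sequence; task $k$ has a data distribution $D_k$ over pairs $(x,y)$ and trainable matrices $A_k\in\mathbb{R}^{d_{in}\times r}$, $B_k\in\mathbb{R}^{r\times d_{out}}$, with $r\le\min(d_{in},d_{out})$. The training loss for task $k$ is $$\mathcal{L}(\tilde A_k,B_k)=\mathbb{E}_{(x,y)\sim D_k}\big[\mathcal{L}_{CE}\big(f(x;W_{base}+\tilde A_kB_k),y\big)\big],$$ where $\mathcal{L}_{CE}$ is the cross-entropy loss; it is assumed to be differentiable in $(\tilde A_k,B_k)$. Cumulative projection matrix. $P_0=I$. After task $j$ is optimized, with resulting update $\Delta W_j=P_{j-1}A_jB_j$ and singular value decomposition $\Delta W_j=U_jS_jV_j^T$, let $U_{j,r}\in\mathbb{R}^{d_{in}\times r}$ consist of the top $r$ left singular vectors, and set $P_j=P_{j-1}-U_{j,r}U_{j,r}^T$. It is a standing assumption that each $P_j$ is an orthogonal projection matrix, i.e. symmetric and idempotent. *)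

theory Defs
  imports "HOL-Probability.Probability"
begin

text \<open>
  A matrix with rows indexed by \<^typ>\<open>'m\<close> and columns indexed by \<^typ>\<open>'n\<close> has type
  \<^typ>\<open>real ^ 'n ^ 'm\<close>; the index types \<open>'i\<close>, \<open>'o\<close>, \<open>'r\<close> stand for the dimensions
  \<open>d_in\<close>, \<open>d_out\<close> and the rank \<open>r\<close>.
\<close>

subsection \<open>Frobenius inner product and matrix gradients\<close>

definition frobenius_inner :: "real ^ 'n ^ 'm \<Rightarrow> real ^ 'n ^ 'm \<Rightarrow> real" where
  "frobenius_inner X Y = trace (transpose X ** Y)"

definition matrix_gradient :: "(real ^ 'n ^ 'm \<Rightarrow> real) \<Rightarrow> real ^ 'n ^ 'm \<Rightarrow> real ^ 'n ^ 'm" where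
  "matrix_gradient g X = (THE G. (g has_derivative frobenius_inner G) (at X))"

lemma frobenius_inner_eq_inner: "frobenius_inner X Y = X \<bullet> Y"
proof -
  have "frobenius_inner X Y = (\<Sum>j\<in>UNIV. \<Sum>i\<in>UNIV. X $ i $ j * Y $ i $ j)"
    by (simp add: frobenius_inner_def trace_def matrix_matrix_mult_def transpose_def)
  also have "\<dots> = (\<Sum>i\<in>UNIV. \<Sum>j\<in>UNIV. X $ i $ j * Y $ i $ j)"
    by (rule sum.swap)
  also have "\<dots> = X \<bullet> Y"
    by (simp add: inner_vec_def)
  finally show ?thesis .
qed

text \<open>The gradient exists and is unique at every point of differentiability.\<close>

lemma matrix_gradient_eqI:
  assumes "(g has_derivative frobenius_inner G) (at X)"
  shows "matrix_gradient g X = G"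
  unfolding matrix_gradient_def
proof (rule the_equality)
  show "(g has_derivative frobenius_inner G) (at X)" by (rule assms)
next
  fix G' assume "(g has_derivative frobenius_inner G') (at X)"
  then have "frobenius_inner G' = frobenius_inner G"
    using assms has_derivative_unique by blast
  then have "\<forall>Y. G' \<bullet> Y = G \<bullet> Y"
    by (metis frobenius_inner_eq_inner)
  then show "G' = G"
    using vector_eq_ldot[of G' G] vector_eq_rdot[of G' G] by (metis inner_commute)
qed

lemma has_derivative_matrix_gradient:
  assumes "g differentiable (at X)"
  shows "(g has_derivative frobenius_inner (matrix_gradient g X)) (at X)"
proof -
  obtain g' where g': "(g has_derivative g') (at X)"
    using assms by (auto simp: differentiable_def)
  then have lin: "linear g'"
    by (rule has_derivative_linear)
  have "g' = frobenius_inner (adjoint g' 1)"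
  proof
    fix Y
    show "g' Y = frobenius_inner (adjoint g' 1) Y"
      using adjoint_works[OF lin, of Y 1]
      by (simp add: frobenius_inner_eq_inner inner_commute)
  qed
  with g' have "(g has_derivative frobenius_inner (adjoint g' 1)) (at X)"
    by simp
  then show ?thesis
    using matrix_gradient_eqI by metis
qed

subsection \<open>Training loss\<close>

definition softmax :: "real ^ 'c \<Rightarrow> real ^ 'c" where
  "softmax z = (\<chi> c. exp (z $ c) / (\<Sum>c'\<in>UNIV. exp (z $ c')))"

text \<open>Cross-entropy of a vector of logits against a class label.\<close>

definition cross_entropy :: "real ^ 'c \<Rightarrow> 'c \<Rightarrow> real" where
  "cross_entropy z y = - ln (softmax z $ y)"

definition sample_loss ::
    "('x \<Rightarrow> real ^ 'o ^ 'i \<Rightarrow> real ^ 'c) \<Rightarrow> real ^ 'o ^ 'i \<Rightarrow>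
     real ^ 'r ^ 'i \<Rightarrow> real ^ 'o ^ 'r \<Rightarrow> 'x \<times> 'c \<Rightarrow> real" where
  "sample_loss f W_base At B = (\<lambda>(x, y). cross_entropy (f x (W_base + At ** B)) y)"

definition training_loss ::
    "('x \<Rightarrow> real ^ 'o ^ 'i \<Rightarrow> real ^ 'c) \<Rightarrow> real ^ 'o ^ 'i \<Rightarrow> ('x \<times> 'c) measure \<Rightarrow>
     real ^ 'r ^ 'i \<Rightarrow> real ^ 'o ^ 'r \<Rightarrow> real" where
  "training_loss f W_base D At B = (\<integral>z. sample_loss f W_base At B z \<partial>D)"

subsection \<open>Cumulative projection matrices\<close>

text \<open>
  Thin singular value decomposition \<open>M = U S V\<^sup>T\<close>: \<open>u l\<close>, \<open>v l\<close> are the columns of \<open>U\<close>, \<open>V\<close> and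
  \<open>s l\<close> the diagonal entries of \<open>S\<close>, for \<open>l < min d_in d_out\<close>.  The families are indexed by
  natural numbers because the singular values have to be ordered, which the index types are not.
\<close>

definition is_svd ::
    "real ^ 'o ^ 'i \<Rightarrow> (nat \<Rightarrow> real ^ 'i) \<Rightarrow> (nat \<Rightarrow> real) \<Rightarrow> (nat \<Rightarrow> real ^ 'o) \<Rightarrow> bool" where
  "is_svd M u s v \<longleftrightarrow>
     (\<forall>a < min CARD('i) CARD('o). \<forall>b < min CARD('i) CARD('o).
        u a \<bullet> u b = (if a = b then 1 else 0) \<and> v a \<bullet> v b = (if a = b then 1 else 0)) \<and>
     (\<forall>a < min CARD('i) CARD('o). 0 \<le> s a) \<and>
     (\<forall>b < min CARD('i) CARD('o). \<forall>a \<le> b. s b \<le> s a) \<and>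
     M = (\<chi> i j. \<Sum>l < min CARD('i) CARD('o). u l $ i * s l * v l $ j)"

text \<open>
  The columns of \<open>U\<close> are the left singular vectors to the \<open>r\<close> largest singular values in some
  SVD of \<open>M\<close>; \<open>e\<close> enumerates the index type \<open>'r\<close>.
\<close>

definition top_left_singular_vectors :: "real ^ 'o ^ 'i \<Rightarrow> real ^ 'r ^ 'i \<Rightarrow> bool" where
  "top_left_singular_vectors M U \<longleftrightarrow>
     (\<exists>u s v. \<exists>e :: 'r \<Rightarrow> nat. is_svd M u s v \<and> bij_betw e UNIV {..<CARD('r)} \<and>
        (\<forall>l. column l U = u (e l)))"

definition cumulative_projections ::
    "nat \<Rightarrow> (nat \<Rightarrow> real ^ 'r ^ 'i) \<Rightarrow> (nat \<Rightarrow> real ^ 'o ^ 'r) \<Rightarrow> (nat \<Rightarrow> real ^ 'i ^ 'i) \<Rightarrow> bool" where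
  "cumulative_projections n A B P \<longleftrightarrow>
     P 0 = mat 1 \<and>
     (\<forall>j \<in> {1..n}. \<exists>U :: real ^ 'r ^ 'i.
        top_left_singular_vectors (P (j - 1) ** A j ** B j) U \<and>
        P j = P (j - 1) - U ** transpose U)"

definition orthogonal_projection_matrix :: "real ^ 'n ^ 'n \<Rightarrow> bool" where
  "orthogonal_projection_matrix P \<longleftrightarrow> transpose P = P \<and> P ** P = P"

end

theory Submission
  imports Defs
begin

text \<open>By the chain rule, the derivative of A \<mapsto> L(PA, B) in direction Y is \<langle>G,
  PY\<rangle>, where G is the gradient of L in its first argument at PA. Left multiplication by P
  has Frobenius adjoint left multiplication by P^T, so the new gradient is P^T G
  (\<open>matrix_gradient_compose_matrix_mult\<close>), which is PG by symmetry of P. The columns of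
  PG are P applied to the columns of G, hence lie in the range of P, and idempotence gives (I - P)PG
  = (P - P^2)G = 0.\<close>

lemma bounded_linear_matrix_mult_right:
  fixes P :: "real ^ 'm ^ 'p"
  shows "bounded_linear (\<lambda>X :: real ^ 'n ^ 'm. P ** X)"
proof -
  have "linear (\<lambda>X :: real ^ 'n ^ 'm. P ** X)"
    by (rule linearI)
      (simp_all add: vec_eq_iff matrix_matrix_mult_def sum_distrib_left distrib_left
        sum.distrib mult.left_commute)
  then show ?thesis
    by (simp add: linear_conv_bounded_linear)
qed

lemma matrix_diff_rdistrib:
  fixes A B :: "real ^ 'm ^ 'p"
  shows "(A - B) ** C = A ** C - B ** C"
  by (simp add: vec_eq_iff matrix_matrix_mult_def left_diff_distrib sum_subtractf)

text \<open>The adjoint identity: both sides are the trace of G^T P X, bracketed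
  differently.\<close>

lemma frobenius_inner_matrix_mult_right:
  "frobenius_inner G (P ** X) = frobenius_inner (transpose P ** G) X"
  by (simp add: frobenius_inner_def matrix_transpose_mul matrix_mul_assoc)

lemma matrix_gradient_compose_matrix_mult:
  fixes P :: "real ^ 'm ^ 'p" and A :: "real ^ 'n ^ 'm"
  assumes "g differentiable (at (P ** A))"
  shows "matrix_gradient (\<lambda>X. g (P ** X)) A = transpose P ** matrix_gradient g (P ** A)"
proof (rule matrix_gradient_eqI)
  have "((\<lambda>X. P ** X) has_derivative (\<lambda>X. P ** X)) (at A)"
    by (rule bounded_linear_imp_has_derivative[OF bounded_linear_matrix_mult_right])
  \<comment> \<open>The chain rule gives the derivative as the pairing of the gradient at
    \<open>P ** A\<close> with \<open>P ** Y\<close>; moving \<open>P\<close> across the pairing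
    brings it into the form that characterises a gradient.\<close>
  from has_derivative_compose[OF this has_derivative_matrix_gradient[OF assms]]
  show "((\<lambda>X. g (P ** X)) has_derivative
      frobenius_inner (transpose P ** matrix_gradient g (P ** A))) (at A)"
    by (simp add: frobenius_inner_matrix_mult_right)
qed

lemma column_matrix_mult_in_span:
  fixes P :: "real ^ 'm ^ 'p"
  shows "column l (P ** G) \<in> span (columns P)"
proof -
  have "column l (P ** G) = P *v column l G"
    by (simp add: vec_eq_iff column_def matrix_matrix_mult_def matrix_vector_mult_def)
  then show ?thesis
    using matrix_vector_mult_in_columnspace[of P] by simp
qed

text \<open>The loss is assumed jointly differentiable, whereas the gradient is taken with B fixed;
  composing with the affine embedding x \<mapsto> (x, y) bridges the two.\<close>

lemma differentiable_fst_section: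
  assumes "(\<lambda>(x, y). h x y) differentiable (at (x, y))"
  shows "(\<lambda>x. h x y) differentiable (at x)"
proof -
  have "(\<lambda>x. (x, y)) differentiable (at x)"
    by (auto simp: differentiable_def intro!: exI derivative_eq_intros)
  from differentiable_compose[OF assms this] show ?thesis
    by simp
qed

theorem lemma1:
  fixes f :: "'x \<Rightarrow> real ^ 'o ^ 'i \<Rightarrow> real ^ 'c"
    and W_base :: "real ^ 'o ^ 'i"
    and D :: "nat \<Rightarrow> ('x \<times> 'c) measure"
    and A_opt :: "nat \<Rightarrow> real ^ 'r ^ 'i"
    and B_opt :: "nat \<Rightarrow> real ^ 'o ^ 'r"
    and P :: "nat \<Rightarrow> real ^ 'i ^ 'i"
    and k :: nat
  assumes rank: "CARD('r) \<le> min CARD('i) CARD('o)"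
    and k: "k \<ge> 1"
    and cumulative: "cumulative_projections (k - 1) A_opt B_opt P"
    and projections: "\<And>j. j \<le> k - 1 \<Longrightarrow> orthogonal_projection_matrix (P j)"
    and distribution: "prob_space (D k)"
    and loss_defined: "\<And>(At :: real ^ 'r ^ 'i) (B :: real ^ 'o ^ 'r).
          integrable (D k) (sample_loss f W_base At B)"
    and loss_differentiable: "\<And>p :: (real ^ 'r ^ 'i) \<times> (real ^ 'o ^ 'r).
          (\<lambda>(At, B). training_loss f W_base (D k) At B) differentiable (at p)"
  shows "\<forall>(A :: real ^ 'r ^ 'i) (B :: real ^ 'o ^ 'r).
     matrix_gradient (\<lambda>X. training_loss f W_base (D k) (P (k - 1) ** X) B) A
       = P (k - 1) ** matrix_gradient (\<lambda>At. training_loss f W_base (D k) At B) (P (k - 1) ** A) \<and>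
     (\<forall>l. column l (matrix_gradient (\<lambda>X. training_loss f W_base (D k) (P (k - 1) ** X) B) A)
       \<in> span (columns (P (k - 1)))) \<and>
     (mat 1 - P (k - 1))
       ** matrix_gradient (\<lambda>X. training_loss f W_base (D k) (P (k - 1) ** X) B) A = 0"
proof (intro allI)
  fix A :: "real ^ 'r ^ 'i" and B :: "real ^ 'o ^ 'r"
  let ?P = "P (k - 1)" and ?L = "\<lambda>At. training_loss f W_base (D k) At B"
  have sym: "transpose ?P = ?P" and idem: "?P ** ?P = ?P"
    using projections[of "k - 1"] by (simp_all add: orthogonal_projection_matrix_def)
  have grad: "matrix_gradient (\<lambda>X. ?L (?P ** X)) A = ?P ** matrix_gradient ?L (?P ** A)"
    using matrix_gradient_compose_matrix_mult[OF
        differentiable_fst_section[OF loss_differentiable[of "(?P ** A, B)"]]]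
    \<comment> \<open>Symmetry of the projection enters here, replacing the transpose left by the
      adjoint.\<close>
    by (simp only: sym)
  moreover have "(mat 1 - ?P) ** (?P ** G) = 0" for G :: "real ^ 'r ^ 'i"
    \<comment> \<open>Reassociating exposes \<open>?P ** ?P\<close> for \<open>idem\<close>; the
      index \<open>k - 1\<close> has to keep the form it has in that fact.\<close>
    by (simp add: matrix_mul_assoc matrix_diff_rdistrib idem del: One_nat_def)
  ultimately show "matrix_gradient (\<lambda>X. ?L (?P ** X)) A = ?P ** matrix_gradient ?L (?P ** A) \<and>
      (\<forall>l. column l (matrix_gradient (\<lambda>X. ?L (?P ** X)) A) \<in> span (columns ?P)) \<and>
      (mat 1 - ?P) ** matrix_gradient (\<lambda>X. ?L (?P ** X)) A = 0"
    by (simp add: column_matrix_mult_in_span)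
qed

end
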